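(* Let $P$ be an $n$-element poset with connected components $P_1,\dots,P_r$. Let $n_i=|P_i|$ and let $t_i$ denote the number of tangled labelings of $P_i$. A labeling $L$ of $P$ is tangled if and only if there is some $i\in[r]$ such that $\operatorname{st}(L|_{P_i})$ is a tangled labeling of $P_i$ and $L^{-1}(n-1),L^{-1}(n)\in P_i$. Consequently (for $n\ge 2$), the number of tangled labelings of $P$ is \[(n-2)!\sum_{i=1}^r\frac{t_i}{(n_i-2)!},\] where terms with $n_i=1$ (for which $t_i=0$) are taken to be $0$.
   Context: A labeling of a finite $n$-element poset $P$ is a bijection $L:P\to[n]$; a linear extension is a labeling with $L(x)\le L(y)$ whenever $x\le_P y$. The connected components of $P$ are the subposets formed by the connected components of its Hasse diagram. For a subset $S\subseteq P$ with $|S|=s$ and an injective $f:S\to\mathbb Z$, the standardization $\operatorname{st}(f)$ is the unique bijection $S\to[s]$ with $\operatorname{st}(f)(x)<\operatorname{st}(f)(y)$ iff $f(x)<f(y)$. For a labeling $L$ and a non-maximal $x\in P$, the $L$-successor of $x$ is the element $y>_P x$ minimizing $L(y)$. The promotion chain of $L$ is $v_1<_P\cdots<_P v_m$, where $v_1=L^{-1}(1)$, $v_{i+1}$ is the $L$-successor of $v_i$ as long as $v_i$ is not maximal, and $v_m$ is maximal. Extended promotion is defined by $\partial(L)(x)=L(x)-1$ if $x$ is not in the promotion chain, $\partial(L)(v_i)=L(v_{i+1})-1$ for $1\le i\le m-1$, and $\partial(L)(v_m)=n$. A labeling $L$ of an $n$-element poset is tangled if $n\ge 2$ and $\partial^{n-2}(L)$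 is not a linear extension (so the unique labeling of a $1$-element poset is not tangled). *)

theory Defs
  imports Complex_Main "HOL-Library.FuncSet"
begin

text \<open>
  A finite poset is given by a finite carrier \<open>P\<close> and a relation \<open>le\<close> with
  \<open>partial_order_on P le\<close>; the subposet on \<open>C \<subseteq> P\<close> is \<open>(C, Restr le C)\<close>. The set of elements
  strictly above \<open>x\<close> is \<open>aboveS le x\<close>, so \<open>x\<close> is maximal iff \<open>aboveS le x = {}\<close>.
  Labelings are functions that are \<open>undefined\<close> outside the carrier, so that they can be counted.
\<close>

definition labelings :: "'a set \<Rightarrow> ('a \<Rightarrow> nat) set" where
  "labelings P = {L \<in> extensional P. bij_betw L P {1..card P}}"

definition linear_extension :: "'a set \<Rightarrow> 'a rel \<Rightarrow> ('a \<Rightarrow> nat) \<Rightarrow> bool" where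
  "linear_extension P le L \<longleftrightarrow> L \<in> labelings P \<and> (\<forall>(x, y) \<in> le. L x \<le> L y)"

definition hasse_diagram :: "'a rel \<Rightarrow> 'a rel" where
  "hasse_diagram le =
     {(x, y). y \<in> aboveS le x \<and> \<not> (\<exists>z. z \<in> aboveS le x \<and> y \<in> aboveS le z)}"

definition poset_components :: "'a set \<Rightarrow> 'a rel \<Rightarrow> 'a set set" where
  "poset_components P le = P // Restr ((hasse_diagram le \<union> (hasse_diagram le)\<inverse>)\<^sup>*) P"

definition standardization :: "'a set \<Rightarrow> ('a \<Rightarrow> 'b::linorder) \<Rightarrow> 'a \<Rightarrow> nat" where
  "standardization S f =
     (THE g. g \<in> extensional S \<and> bij_betw g S {1..card S} \<and>
             (\<forall>x\<in>S. \<forall>y\<in>S. g x < g y \<longleftrightarrow> f x < f y))"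

definition L_successor :: "'a rel \<Rightarrow> ('a \<Rightarrow> nat) \<Rightarrow> 'a \<Rightarrow> 'a" where
  "L_successor le L x = arg_min_on L (aboveS le x)"

inductive_set promotion_chain :: "'a set \<Rightarrow> 'a rel \<Rightarrow> ('a \<Rightarrow> nat) \<Rightarrow> 'a set"
  for P :: "'a set" and le :: "'a rel" and L :: "'a \<Rightarrow> nat" where
  first: "v \<in> P \<Longrightarrow> L v = 1 \<Longrightarrow> v \<in> promotion_chain P le L"
| succ: "v \<in> promotion_chain P le L \<Longrightarrow> aboveS le v \<noteq> {} \<Longrightarrow>
           L_successor le L v \<in> promotion_chain P le L"

text \<open>
  In the chain \<open>v\<^sub>1 < \<dots> < v\<^sub>m\<close> the element \<open>v\<^sub>m\<close> is the only maximal one, and the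
  \<open>L\<close>-successor of any other \<open>v\<^sub>i\<close> is the next element of the chain.
\<close>

definition ext_promotion :: "'a set \<Rightarrow> 'a rel \<Rightarrow> ('a \<Rightarrow> nat) \<Rightarrow> 'a \<Rightarrow> nat" where
  "ext_promotion P le L = (\<lambda>x\<in>P.
     if x \<notin> promotion_chain P le L then L x - 1
     else if aboveS le x \<noteq> {} then L (L_successor le L x) - 1
     else card P)"

definition tangled :: "'a set \<Rightarrow> 'a rel \<Rightarrow> ('a \<Rightarrow> nat) \<Rightarrow> bool" where
  "tangled P le L \<longleftrightarrow> L \<in> labelings P \<and> card P \<ge> 2 \<and>
     \<not> linear_extension P le ((ext_promotion P le ^^ (card P - 2)) L)"

definition num_tangled :: "'a set \<Rightarrow> 'a rel \<Rightarrow> nat" where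
  "num_tangled P le = card {L. tangled P le L}"

end

theory Submission
  imports Defs "HOL-Library.Infinite_Set"
begin

text \<open>
  Extended promotion acts on the component containing the label 1 as extended promotion of the
  standardized labeling, and does not change the standardizations on the other components; the set
  of labels occupied by a component rotates by one. Hence \<open>n - 2\<close> promotions of \<open>P\<close> promote each
  component \<open>C\<close> once for every element of \<open>C\<close> whose label is at most \<open>n - 2\<close>, i.e. at least
  \<open>|C| - 1\<close> times unless the labels \<open>n - 1\<close> and \<open>n\<close> both lie in \<open>C\<close>. As \<open>|C| - 1\<close> promotions always
  sort a labeling of \<open>C\<close>, only a component containing both labels can remain unsorted.
\<close>

section \<open>Order-equivalent injections\<close>

text \<open>Order equivalence is kept as a relation instead of comparing standardizations directly:
  it is transitive, relates functions into different orders, and can be followed through a promotion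
  step without unfolding a definite description.\<close>

definition same_order_on :: "'a set \<Rightarrow> ('a \<Rightarrow> 'b::linorder) \<Rightarrow> ('a \<Rightarrow> 'c::linorder) \<Rightarrow> bool" where
  "same_order_on S f g \<longleftrightarrow> (\<forall>x\<in>S. \<forall>y\<in>S. f x < f y \<longleftrightarrow> g x < g y)"

lemma same_order_onD:
  "same_order_on S f g \<Longrightarrow> x \<in> S \<Longrightarrow> y \<in> S \<Longrightarrow> f x < f y \<longleftrightarrow> g x < g y"
  by (auto simp: same_order_on_def)

lemma same_order_on_leD:
  "same_order_on S f g \<Longrightarrow> x \<in> S \<Longrightarrow> y \<in> S \<Longrightarrow> f x \<le> f y \<longleftrightarrow> g x \<le> g y"
  by (auto simp: same_order_on_def simp flip: not_less)

lemma same_order_on_trans: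
  "same_order_on S f g \<Longrightarrow> same_order_on S g h \<Longrightarrow> same_order_on S f h"
  by (auto simp: same_order_on_def)

lemma card_below_inj:
  fixes A :: "'b::linorder set"
  assumes "finite A" "a \<in> A" "b \<in> A" "card {z\<in>A. z < a} = card {z\<in>A. z < b}"
  shows "a = b"
proof -
  have *: "card {z\<in>A. z < u} < card {z\<in>A. z < v}" if "u < v" "u \<in> A" for u v
  proof (rule psubset_card_mono)
    show "{z\<in>A. z < u} \<subset> {z\<in>A. z < v}"
      using that by (auto intro: less_trans)
  qed (use assms in auto)
  show ?thesis
    using *[of a b] *[of b a] assms by (cases a b rule: linorder_cases) auto
qed

text \<open>The rank of \<open>f x\<close> within the image is the number of points of
  \<open>S\<close> with a smaller value, which the order type alone determines. In the common image,
  equal ranks force equal values.\<close>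

lemma same_order_on_eq:
  fixes f g :: "'a \<Rightarrow> 'b::linorder"
  assumes "finite S" "inj_on f S" "inj_on g S" "f ` S = g ` S" "same_order_on S f g" "x \<in> S"
  shows "f x = g x"
proof (rule card_below_inj)
  show "finite (f ` S)" "f x \<in> f ` S" "g x \<in> f ` S"
    using assms by auto
  have below: "card {z \<in> h ` S. z < h x} = card {y\<in>S. h y < h x}" if "inj_on h S" for h :: "'a \<Rightarrow> 'b"
  proof -
    have "{z \<in> h ` S. z < h x} = h ` {y\<in>S. h y < h x}" by auto
    then show ?thesis
      using that by (simp add: card_image inj_on_subset)
  qed
  have "{y\<in>S. f y < f x} = {y\<in>S. g y < g x}"
    using assms by (auto simp: same_order_on_def)
  then show "card {z \<in> f ` S. z < f x} = card {z \<in> f ` S. z < g x}"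
    using below[of f] below[of g] assms by simp
qed

lemma labelings_same_order_unique:
  assumes "finite S" "g \<in> labelings S" "h \<in> labelings S" "same_order_on S g h"
  shows "g = h"
proof (rule extensionalityI[of _ S])
  show "g x = h x" if "x \<in> S" for x
    by (rule same_order_on_eq[of S]) (use assms that in \<open>auto simp: labelings_def bij_betw_def\<close>)
qed (use assms in \<open>auto simp: labelings_def\<close>)

lemma standardization_exists:
  fixes f :: "'a \<Rightarrow> 'b::linorder"
  assumes "finite S" "inj_on f S"
  obtains g where "g \<in> labelings S" "same_order_on S g f"
proof -
  \<comment> \<open>The rank of \<open>f x\<close>; counting with \<open>\<le>\<close> includes
    \<open>x\<close> itself, so ranks start at 1.\<close>
  define g where "g = (\<lambda>x\<in>S. card {y\<in>S. f y \<le> f x})"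
  have less: "g x < g y" if "x \<in> S" "y \<in> S" "f x < f y" for x y
  proof -
    have "{z\<in>S. f z \<le> f x} \<subset> {z\<in>S. f z \<le> f y}"
      using that by (auto dest: order.strict_trans1 intro: less_imp_le simp flip: not_less)
    then show ?thesis
      using that assms by (auto simp: g_def intro: psubset_card_mono)
  qed
  have so: "same_order_on S g f"
    unfolding same_order_on_def using less
    by (metis assms(2) inj_on_eq_iff linorder_neqE order_less_asym order_less_irrefl)
  have inj: "inj_on g S"
    by (intro inj_onI) (metis assms(2) inj_on_eq_iff less less_irrefl linorder_neqE)
  have "g x \<in> {1..card S}" if "x \<in> S" for x
  proof -
    have "card {y\<in>S. f y \<le> f x} \<le> card S"
      by (rule card_mono) (use assms in auto)
    moreover have "card {y\<in>S. f y \<le> f x} > 0"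
      using that assms by (auto simp: card_gt_0_iff)
    ultimately show ?thesis using that by (simp add: g_def)
  qed
  then have "g ` S \<subseteq> {1..card S}" by auto
  moreover have "card (g ` S) = card {1..card S}"
    using inj by (simp add: card_image)
  ultimately have "g ` S = {1..card S}"
    by (simp add: card_subset_eq)
  then have "g \<in> labelings S"
    using inj by (auto simp: labelings_def bij_betw_def g_def)
  then show thesis using so that by blast
qed

lemma standardization_eqI:
  assumes "finite S" "g \<in> labelings S" "same_order_on S g f"
  shows "standardization S f = g"
  unfolding standardization_def
proof (rule the_equality)
  show "g \<in> extensional S \<and> bij_betw g S {1..card S} \<and> (\<forall>x\<in>S. \<forall>y\<in>S. (g x < g y) = (f x < f y))"
    using assms by (auto simp: labelings_def same_order_on_def)
next
  fix h
  assume "h \<in> extensional S \<and> bij_betw h S {1..card S} \<and> (\<forall>x\<in>S. \<forall>y\<in>S. (h x < h y) = (f x < f y))"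
  then have "h \<in> labelings S" "same_order_on S h g"
    using assms(3) by (auto simp: labelings_def same_order_on_def)
  then show "h = g"
    using assms labelings_same_order_unique by blast
qed

lemma
  assumes "finite S" "inj_on f S"
  shows standardization_labeling: "standardization S f \<in> labelings S"
    and standardization_same_order: "same_order_on S (standardization S f) f"
  using standardization_exists[OF assms] standardization_eqI[OF assms(1)] by metis+

section \<open>Extended promotion\<close>

locale finite_poset =
  fixes P :: "'a set" and le :: "'a rel"
  assumes finite: "finite P" and poset: "partial_order_on P le"
begin

lemma
  shows le_subset: "le \<subseteq> P \<times> P"
    and le_refl: "x \<in> P \<Longrightarrow> (x, x) \<in> le"
    and le_trans: "(x, y) \<in> le \<Longrightarrow> (y, z) \<in> le \<Longrightarrow> (x, z) \<in> le"
    and le_antisym: "(x, y) \<in> le \<Longrightarrow> (y, x) \<in> le \<Longrightarrow> x = y"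
  using poset
  by (auto simp: partial_order_on_def preorder_on_def refl_on_def antisym_def elim: transE)

lemma finite_aboveS: "finite (aboveS le x)"
  by (rule finite_subset[OF _ finite]) (use le_subset in \<open>auto simp: aboveS_def\<close>)

lemma aboveS_trans: "y \<in> aboveS le x \<Longrightarrow> z \<in> aboveS le y \<Longrightarrow> z \<in> aboveS le x"
  using le_trans le_antisym by (fastforce simp: aboveS_def)

text \<open>Components are defined by the Hasse diagram, whereas the later arguments use closure
  under \<open>le\<close>; this links the two. An element \<open>z\<close> strictly between
  \<open>x\<close> and \<open>y\<close> splits the pair into two pairs with strictly smaller
  measure: \<open>y\<close> leaves the first difference and \<open>z\<close> the second.\<close>

lemma hasse_rtrancl: "(x, y) \<in> le \<Longrightarrow> (x, y) \<in> (hasse_diagram le)\<^sup>*"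
proof (induction "card (aboveS le x - aboveS le y)" arbitrary: x y rule: less_induct)
  case less
  show ?case
  proof (cases "x = y \<or> (x, y) \<in> hasse_diagram le")
    case False
    then obtain z where z: "z \<in> aboveS le x" "y \<in> aboveS le z"
      using less.prems by (auto simp: hasse_diagram_def aboveS_def)
    have y: "y \<in> aboveS le x"
      using False less.prems by (auto simp: aboveS_def)
    have fin: "finite (aboveS le x - aboveS le y)"
      using finite_aboveS by blast
    have "aboveS le y \<subseteq> aboveS le z" "aboveS le z \<subseteq> aboveS le x"
      using z aboveS_trans by blast+
    moreover have "y \<notin> aboveS le y" "z \<notin> aboveS le z" "z \<notin> aboveS le y"
      using z le_antisym by (auto simp: aboveS_def)
    ultimately have "aboveS le x - aboveS le z \<subset> aboveS le x - aboveS le y"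
      "aboveS le z - aboveS le y \<subset> aboveS le x - aboveS le y"
      using z y by blast+
    then have "(x, z) \<in> (hasse_diagram le)\<^sup>*" "(z, y) \<in> (hasse_diagram le)\<^sup>*"
      using less.hyps z psubset_card_mono[OF fin] by (auto simp: aboveS_def)
    then show ?thesis by (rule rtrancl_trans)
  qed auto
qed

end

section \<open>A single promotion step\<close>

locale labeled_poset = finite_poset P le
  for P :: "'a set" and le :: "'a rel" +
  fixes L :: "'a \<Rightarrow> nat"
  assumes labeling: "L \<in> labelings P"
begin

lemma
  shows label_inj: "inj_on L P" and label_image: "L ` P = {1..card P}"
  using labeling by (auto simp: labelings_def bij_betw_def)

lemma label_eq_iff: "x \<in> P \<Longrightarrow> y \<in> P \<Longrightarrow> L x = L y \<longleftrightarrow> x = y"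
  using label_inj by (auto simp: inj_on_eq_iff)

lemma label_range: "x \<in> P \<Longrightarrow> 1 \<le> L x \<and> L x \<le> card P"
  using label_image by (metis atLeastAtMost_iff imageI)

lemma L_successor_above: "aboveS le x \<noteq> {} \<Longrightarrow> L_successor le L x \<in> aboveS le x"
  unfolding L_successor_def by (rule arg_min_if_finite(1)[OF finite_aboveS])

lemma L_successor_least: "y \<in> aboveS le x \<Longrightarrow> L (L_successor le L x) \<le> L y"
  unfolding L_successor_def by (rule arg_min_least[OF finite_aboveS]) auto

lemma L_successor_mem: "aboveS le x \<noteq> {} \<Longrightarrow> L_successor le L x \<in> P"
  using L_successor_above le_subset by (fastforce simp: aboveS_def)

abbreviation "chain \<equiv> promotion_chain P le L"

lemma chain_subset: "chain \<subseteq> P"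
proof
  fix x assume "x \<in> chain"
  then show "x \<in> P"
    by induction (auto intro: L_successor_mem)
qed

lemma chain_above_first:
  assumes "x \<in> chain" "v \<in> P" "L v = 1"
  shows "(v, x) \<in> le"
  using assms(1)
proof induction
  case (first w)
  then show ?case using assms label_eq_iff le_refl by metis
next
  case (succ w)
  then show ?case
    using L_successor_above[of w] le_trans by (auto simp: aboveS_def)
qed

lemma first_in_chain: "v \<in> P \<Longrightarrow> L v = 1 \<Longrightarrow> v \<in> chain"
  by (rule promotion_chain.first)

text \<open>The inductive definition gives the promotion chain only as a set. This recovers its
  sequential structure: of two distinct members, the earlier one has its successor weakly below the
  later one.\<close>

lemma chain_comparable:
  assumes "x \<in> chain" "y \<in> chain"
  shows "x = y \<or> aboveS le x \<noteq> {} \<and> (L_successor le L x, y) \<in> le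
               \<or> aboveS le y \<noteq> {} \<and> (L_successor le L y, x) \<in> le"
proof -
  \<comment> \<open>The successor map made total by fixing maximal elements, so that every chain
    element is an iterate of \<open>s\<close> at the element \<open>v\<close> with label 1.\<close>
  define s where "s = (\<lambda>x. if aboveS le x = {} then x else L_successor le L x)"
  obtain v where v: "v \<in> P" "L v = 1"
    using assms(1) by (induction) auto
  have s_le: "x \<in> P \<Longrightarrow> (x, s x) \<in> le \<and> s x \<in> P" for x
    using L_successor_above[of x] le_refl L_successor_mem by (auto simp: s_def aboveS_def)
  have iter_P: "x \<in> P \<Longrightarrow> (s ^^ i) x \<in> P" for x i
    using s_le by (induction i) auto
  have iter_le: "x \<in> P \<Longrightarrow> (x, (s ^^ i) x) \<in> le" for x i
    using s_le iter_P by (induction i) (auto intro: le_refl le_trans)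
  have chain_iter: "\<exists>i. z = (s ^^ i) v" if "z \<in> chain" for z
    using that
  proof induction
    case (first w)
    then have "w = (s ^^ 0) v" using v label_eq_iff by force
    then show ?case by blast
  next
    case (succ w)
    then obtain i where "w = (s ^^ i) v" by blast
    then have "L_successor le L w = (s ^^ Suc i) v"
      using succ by (simp add: s_def)
    then show ?case by blast
  qed
  have step: "(s ^^ i) v = (s ^^ j) v \<or>
      aboveS le ((s ^^ i) v) \<noteq> {} \<and> (L_successor le L ((s ^^ i) v), (s ^^ j) v) \<in> le"
    if "i < j" for i j
  proof -
    let ?u = "(s ^^ i) v"
    define d where "d = j - Suc i"
    have "(s ^^ j) v = (s ^^ (d + Suc i)) v" using that by (simp add: d_def)
    then have j: "(s ^^ j) v = (s ^^ d) (s ?u)" by (simp only: funpow_add) simp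
    show ?thesis
    proof (cases "aboveS le ?u = {}")
      case True
      have "?u \<in> P" using iter_P v by blast
      then have "(?u, (s ^^ j) v) \<in> le"
        using j True iter_le by (simp add: s_def)
      then show ?thesis using True by (force simp: aboveS_def)
    next
      case False
      then show ?thesis
        using j iter_le[OF L_successor_mem] by (simp add: s_def)
    qed
  qed
  obtain i j where "x = (s ^^ i) v" "y = (s ^^ j) v"
    using assms chain_iter by metis
  then show ?thesis
    using step[of i j] step[of j i] by (cases i j rule: linorder_cases) auto
qed

text \<open>The element that passes its label, lowered by one, to \<open>x\<close>. At the top of
  the chain the value is meaningless, since the successor would minimize over an empty set.\<close>

definition source :: "'a \<Rightarrow> 'a" where
  "source x = (if x \<in> chain then L_successor le L x else x)"

definition top_of_chain :: "'a \<Rightarrow> bool" where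
  "top_of_chain x \<longleftrightarrow> x \<in> chain \<and> aboveS le x = {}"

lemma ext_promotion_eq:
  "x \<in> P \<Longrightarrow> ext_promotion P le L x = (if top_of_chain x then card P else L (source x) - 1)"
  by (auto simp: ext_promotion_def source_def top_of_chain_def)

text \<open>The lower bound 2 says that label 1 is never passed on, so the truncated subtraction in
  promotion loses nothing. If \<open>source x\<close> had label 1, then \<open>x\<close> off the
  chain would itself start the chain, and \<open>x\<close> on the chain would lie above its own
  strict upper bound.\<close>

lemma
  assumes "x \<in> P" "\<not> top_of_chain x"
  shows source_mem: "source x \<in> P"
    and le_source: "(x, source x) \<in> le"
    and label_source: "2 \<le> L (source x)" "L (source x) \<le> card P"
proof -
  show mem: "source x \<in> P" and le: "(x, source x) \<in> le"
    using assms L_successor_mem[of x] L_successor_above[of x] le_refl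
    by (auto simp: source_def top_of_chain_def aboveS_def)
  have "L (source x) \<noteq> 1"
  proof
    assume *: "L (source x) = 1"
    show False
    proof (cases "x \<in> chain")
      case True
      then have "(source x, x) \<in> le" using chain_above_first * mem by blast
      then have "source x = x" using le le_antisym by blast
      then show False
        using True assms L_successor_above[of x] by (auto simp: source_def top_of_chain_def aboveS_def)
    next
      case False
      then show False using * assms first_in_chain[of x] by (simp add: source_def)
    qed
  qed
  then show "2 \<le> L (source x)" "L (source x) \<le> card P"
    using label_range[OF mem] by auto
qed

text \<open>Successors of chain elements stay in the chain, so a chain element and an outside
  element have different sources. Two distinct chain elements with a common successor would
  contradict \<open>chain_comparable\<close>, because that successor lies strictly above
  both.\<close>

lemma source_inj:
  assumes "x \<in> P" "y \<in> P" "\<not> top_of_chain x" "\<not> top_of_chain y" "source x = source y"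
  shows "x = y"
proof -
  have in_chain: "L_successor le L u \<in> chain" if "u \<in> chain" "\<not> top_of_chain u" for u
    using that by (auto simp: top_of_chain_def intro: promotion_chain.succ)
  have iff: "x \<in> chain \<longleftrightarrow> y \<in> chain"
    using assms(3-5) in_chain[of x] in_chain[of y] by (simp add: source_def split: if_splits)
  show ?thesis
  proof (cases "x \<in> chain")
    case True
    then have y: "y \<in> chain" and nonempty: "aboveS le x \<noteq> {}" "aboveS le y \<noteq> {}"
      and eq: "L_successor le L x = L_successor le L y"
      using iff assms by (simp_all add: source_def top_of_chain_def)
    have "(L_successor le L y, x) \<notin> le" "(L_successor le L x, y) \<notin> le"
      using L_successor_above[OF nonempty(1)] L_successor_above[OF nonempty(2)] eq le_antisym
      by (auto simp: aboveS_def)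
    then show ?thesis
      using chain_comparable[OF True y] by blast
  next
    case False
    then show ?thesis using iff assms(5) by (simp add: source_def)
  qed
qed

lemma top_of_chain_unique: "top_of_chain x \<Longrightarrow> top_of_chain y \<Longrightarrow> x = y"
  using chain_comparable[of x y] by (auto simp: top_of_chain_def)

lemma ext_promotion_inj: "inj_on (ext_promotion P le L) P"
proof (rule inj_onI)
  fix x y assume xy: "x \<in> P" "y \<in> P" and eq: "ext_promotion P le L x = ext_promotion P le L y"
  show "x = y"
  proof (cases "top_of_chain x \<or> top_of_chain y")
    case True
    then show ?thesis
      using xy eq top_of_chain_unique label_source[of x] label_source[of y]
      by (auto simp: ext_promotion_eq split: if_splits)
  next
    case False
    then have "L (source x) = L (source y)"
      using xy eq label_source[of x] label_source[of y] by (auto simp: ext_promotion_eq)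
    then show ?thesis
      using False xy source_inj source_mem label_eq_iff by metis
  qed
qed

lemma ext_promotion_labeling: "ext_promotion P le L \<in> labelings P"
proof -
  let ?D = "ext_promotion P le L"
  have "?D x \<in> {1..card P}" if "x \<in> P" for x
    using that label_source[of x] label_range[of x] by (auto simp: ext_promotion_eq)
  then have "?D ` P \<subseteq> {1..card P}" by blast
  moreover have "card (?D ` P) = card {1..card P}"
    using ext_promotion_inj by (simp add: card_image)
  ultimately have "?D ` P = {1..card P}"
    by (simp add: card_subset_eq)
  then show ?thesis
    using ext_promotion_inj by (simp add: labelings_def bij_betw_def ext_promotion_def)
qed

end

section \<open>Iterated promotion and sorting\<close>

context finite_poset
begin

lemma labeled_posetI: "L \<in> labelings P \<Longrightarrow> labeled_poset P le L"
  by unfold_locales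

lemma ext_promotion_iter_labeling:
  "L \<in> labelings P \<Longrightarrow> (ext_promotion P le ^^ k) L \<in> labelings P"
  by (induction k) (auto intro: labeled_poset.ext_promotion_labeling labeled_posetI)

text \<open>Each application of extended promotion freezes one more of the largest labels.\<close>

lemma ext_promotion_iter_frozen:
  assumes "L \<in> labelings P"
  shows "\<lbrakk>z \<in> aboveS le x; card P < (ext_promotion P le ^^ k) L x + k\<rbrakk> \<Longrightarrow>
    (ext_promotion P le ^^ k) L x < (ext_promotion P le ^^ k) L z"
proof (induction k arbitrary: x z)
  case 0
  interpret labeled_poset P le L by (rule labeled_posetI) fact
  have "x \<in> P" using 0 le_subset by (auto simp: aboveS_def)
  then show ?case using 0 label_range[of x] by auto
next
  case (Suc k)
  let ?K = "(ext_promotion P le ^^ k) L"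
  let ?D = "ext_promotion P le ?K"
  interpret labeled_poset P le ?K
    by (rule labeled_posetI[OF ext_promotion_iter_labeling]) fact
  have frozen: "card P < ?K u + k \<Longrightarrow> w \<in> aboveS le u \<Longrightarrow> ?K u < ?K w" for u w
    using Suc.IH by blast
  have mem: "x \<in> P" "z \<in> P" using Suc.prems le_subset by (auto simp: aboveS_def)
  have ntop: "\<not> top_of_chain x" using Suc.prems by (auto simp: top_of_chain_def)
  have Dx: "?D x = ?K (source x) - 1" using mem ntop by (simp add: ext_promotion_eq)
  \<comment> \<open>The source has a label larger by one than the new label of \<open>x\<close>,
    which makes up for the one fewer iteration: it was already frozen.\<close>
  have large: "card P < ?K (source x) + k"
    using Suc.prems Dx label_source[OF mem(1) ntop] by simp
  have "?D x \<le> ?D z"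
  proof (cases "top_of_chain z")
    case True
    then show ?thesis using mem Dx label_source[OF mem(1) ntop] by (simp add: ext_promotion_eq)
  next
    case False
    have "?K (source x) \<le> ?K (source z)"
    \<comment> \<open>On the chain, \<open>source x\<close> minimizes the label above
      \<open>x\<close>, and \<open>source z\<close> is a competitor. Off the chain, \<open>x\<close>
      is its own source and already frozen; hence \<open>z\<close> has a larger label, is frozen
      too, and moving on to \<open>source z\<close> cannot lower it.\<close>
    proof (cases "x \<in> chain")
      case True
      have "source z \<in> aboveS le x"
        using Suc.prems le_source[OF mem(2) False] le_trans le_antisym
        by (fastforce simp: aboveS_def)
      then show ?thesis using True L_successor_least by (auto simp: source_def)
    next
      case out: False
      then have "card P < ?K x + k" using large by (simp add: source_def)
      then have *: "?K x < ?K z" using frozen Suc.prems by blast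
      moreover have "?K z \<le> ?K (source z)"
      proof (cases "source z = z")
        case neq: False
        then have "source z \<in> aboveS le z"
          using le_source[OF mem(2) False] by (simp add: aboveS_def)
        moreover have "card P < ?K z + k" using * \<open>card P < ?K x + k\<close> by simp
        ultimately show ?thesis using frozen by (simp add: less_imp_le)
      qed auto
      ultimately show ?thesis using out by (simp add: source_def)
    qed
    then show ?thesis using Dx mem False by (simp add: ext_promotion_eq)
  qed
  moreover have "?D x \<noteq> ?D z"
    using ext_promotion_inj mem Suc.prems by (auto simp: inj_on_eq_iff aboveS_def)
  ultimately show ?case by simp
qed

text \<open>After \<open>card P - 1\<close> steps every label from 2 upwards is frozen, and label 1
  cannot exceed any other label. One step fewer would leave label 2 uncontrolled, which is where
  tangled labelings arise.\<close>

lemma ext_promotion_iter_linear_extension: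
  assumes "L \<in> labelings P" "card P \<le> k + 1"
  shows "linear_extension P le ((ext_promotion P le ^^ k) L)"
proof -
  let ?K = "(ext_promotion P le ^^ k) L"
  interpret labeled_poset P le ?K
    by (rule labeled_posetI[OF ext_promotion_iter_labeling]) fact
  have "?K x \<le> ?K y" if "(x, y) \<in> le" for x y
  proof (cases "x = y")
    case False
    then have y: "y \<in> aboveS le x" using that by (simp add: aboveS_def)
    have "x \<in> P" "y \<in> P" using that le_subset by auto
    show ?thesis
    proof (cases "card P < ?K x + k")
      case True
      then show ?thesis using ext_promotion_iter_frozen[OF assms(1) y] by (simp add: less_imp_le)
    next
      case False
      then have "?K x \<le> 1" using assms by simp
      then show ?thesis using label_range[OF \<open>y \<in> P\<close>] by simp
    qed
  qed auto
  then show ?thesis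
    using labeling by (auto simp: linear_extension_def)
qed

end

section \<open>Restriction to a union of components\<close>

text \<open>Closure under comparability is the property of components that matters: elements above a
  point of \<open>C\<close> stay in \<open>C\<close>, and a promotion chain lies inside
  \<open>C\<close> or avoids it.\<close>

locale closed_subposet = finite_poset P le
  for P :: "'a set" and le :: "'a rel" +
  fixes C :: "'a set"
  assumes C_subset: "C \<subseteq> P"
    and C_closed: "(x, y) \<in> le \<Longrightarrow> x \<in> C \<longleftrightarrow> y \<in> C"
begin

abbreviation "leC \<equiv> Restr le C"

lemma finite_C: "finite C"
  using C_subset finite finite_subset by blast

sublocale sub: finite_poset C leC
proof
  show "partial_order_on C leC"
    unfolding partial_order_on_def preorder_on_def refl_on_def
    using le_refl le_trans le_antisym C_subset
    by (auto intro!: transI antisymI)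
qed (rule finite_C)

lemma aboveS_sub: "x \<in> C \<Longrightarrow> aboveS leC x = aboveS le x"
  using C_closed by (auto simp: aboveS_def)

text \<open>When label 1 lies in \<open>C\<close>, the whole chain does. Successors are chosen by
  comparing labels within \<open>C\<close> only, so \<open>g\<close> and \<open>L\<close> have the
  same chain there and the same sources.\<close>

lemma same_order_ext_promotion_inside:
  assumes L: "L \<in> labelings P" and g: "g \<in> labelings C" and so: "same_order_on C g L"
    and v: "v \<in> C" "L v = 1"
  shows "same_order_on C (ext_promotion C leC g) (ext_promotion P le L)"
proof -
  interpret A: labeled_poset P le L by (rule labeled_posetI) fact
  interpret B: labeled_poset C leC g by (rule sub.labeled_posetI) fact
  have succ_C: "L_successor le L x \<in> C" if "x \<in> C" "aboveS le x \<noteq> {}" for x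
    using A.L_successor_above[OF that(2)] C_closed that by (auto simp: aboveS_def)
  have succ_eq: "L_successor leC g x = L_successor le L x" if x: "x \<in> C" "aboveS le x \<noteq> {}" for x
  proof -
    let ?a = "L_successor le L x" and ?b = "L_successor leC g x"
    have a: "?a \<in> aboveS le x" "?a \<in> C" using A.L_successor_above succ_C x by auto
    have b: "?b \<in> aboveS le x" "?b \<in> C"
      using B.L_successor_above[of x] B.L_successor_mem[of x] x by (auto simp: aboveS_sub)
    have "L ?a \<le> L ?b" using A.L_successor_least b by blast
    moreover have "g ?b \<le> g ?a" using B.L_successor_least a x by (simp add: aboveS_sub)
    ultimately have "g ?a = g ?b"
      using same_order_on_leD[OF so] a b by (simp add: order_antisym)
    then show ?thesis using B.label_eq_iff a b by simp
  qed
  have gv: "g v = 1"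
  proof -
    have "1 \<in> g ` C" using B.label_image B.label_range[OF v(1)] by auto
    then obtain u where u: "u \<in> C" "g u = 1" by auto
    have "L v \<le> L u" using v A.label_range C_subset u by auto
    then have "g v \<le> g u" using same_order_on_leD[OF so] u v by blast
    then show ?thesis using u B.label_range[OF v(1)] by simp
  qed
  have chain_C: "A.chain \<subseteq> C"
    using A.chain_above_first C_closed v C_subset by blast
  have "x \<in> B.chain" if "x \<in> A.chain" for x
    using that
  proof induction
    case (first w)
    then have "w = v" using v A.label_eq_iff C_subset by (metis subsetD)
    then show ?case using v gv B.first_in_chain by blast
  next
    case (succ w)
    then have "w \<in> C" using B.chain_subset by blast
    then show ?case
      using promotion_chain.succ[of w C leC g] succ.IH succ.hyps succ_eq
      by (simp add: aboveS_sub)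
  qed
  moreover have "x \<in> A.chain" if "x \<in> B.chain" for x
    using that
  proof induction
    case (first w)
    then have "w = v" using v gv B.label_eq_iff by metis
    then show ?case using v C_subset A.first_in_chain by blast
  next
    case (succ w)
    then have "w \<in> C" using B.chain_subset by blast
    then show ?case
      using promotion_chain.succ[of w P le L] succ.IH succ.hyps succ_eq
      by (simp add: aboveS_sub)
  qed
  ultimately have chain: "B.chain = A.chain" by blast
  have top: "B.top_of_chain x \<longleftrightarrow> A.top_of_chain x" if "x \<in> C" for x
    using that chain by (simp add: A.top_of_chain_def B.top_of_chain_def aboveS_sub)
  have source: "B.source x = A.source x" if "x \<in> C" "\<not> A.top_of_chain x" for x
    using that chain succ_eq by (auto simp: A.top_of_chain_def A.source_def B.source_def)
  show ?thesis
    unfolding same_order_on_def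
  proof (intro ballI)
    fix x y assume xy: "x \<in> C" "y \<in> C"
    then have xyP: "x \<in> P" "y \<in> P" using C_subset by auto
    have A: "A.top_of_chain z \<or> 2 \<le> L (A.source z) \<and> L (A.source z) \<le> card P" if "z \<in> P" for z
      using that A.label_source by blast
    have B: "A.top_of_chain z \<or> 2 \<le> g (A.source z) \<and> g (A.source z) \<le> card C \<and> A.source z \<in> C"
      if "z \<in> C" for z
      using that B.label_source[of z] B.source_mem[of z] by (auto simp: source top)
    have "g (A.source x) < g (A.source y) \<longleftrightarrow> L (A.source x) < L (A.source y)"
      if "\<not> A.top_of_chain x" "\<not> A.top_of_chain y"
      using that B[OF xy(1)] B[OF xy(2)] same_order_onD[OF so] by blast
    then show "ext_promotion C leC g x < ext_promotion C leC g y \<longleftrightarrow>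
        ext_promotion P le L x < ext_promotion P le L y"
      \<comment> \<open>The top of the chain receives \<open>card C\<close> and
        \<open>card P\<close> respectively, each exceeding all other new labels; elsewhere the
        labels of equal sources are compared.\<close>
      using A[OF xyP(1)] A[OF xyP(2)] B[OF xy(1)] B[OF xy(2)]
      by (cases "A.top_of_chain x"; cases "A.top_of_chain y")
        (auto simp: A.ext_promotion_eq[OF xyP(1)] A.ext_promotion_eq[OF xyP(2)]
          B.ext_promotion_eq[OF xy(1)] B.ext_promotion_eq[OF xy(2)] top xy source)
  qed
qed

text \<open>The chain lies above the element with label 1, so by closure it misses \<open>C\<close>,
  where every label simply drops by one.\<close>

lemma same_order_ext_promotion_outside:
  assumes L: "L \<in> labelings P" and out: "1 \<notin> L ` C"
  shows "same_order_on C L (ext_promotion P le L)"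
proof -
  interpret A: labeled_poset P le L by (rule labeled_posetI) fact
  have "x \<notin> A.chain" if "x \<in> C" for x
  proof
    assume x: "x \<in> A.chain"
    have "1 \<in> L ` P"
      using A.label_image A.label_range[of x] that C_subset by auto
    then obtain v where v: "v \<in> P" "L v = 1" by auto
    then have "v \<in> C" using A.chain_above_first[OF x] C_closed that by blast
    then show False using out v by force
  qed
  then have "ext_promotion P le L x = L x - 1" "1 \<le> L x" if "x \<in> C" for x
    using that C_subset A.label_range by (auto simp: ext_promotion_def)
  then show ?thesis
    by (fastforce simp: same_order_on_def)
qed

text \<open>A label moves only between comparable elements, so the labels occupied by \<open>C\<close> rotate.\<close>

lemma ext_promotion_labels:
  assumes L: "L \<in> labelings P" and a: "1 \<le> a" "a < card P"
  shows "a \<in> ext_promotion P le L ` C \<longleftrightarrow> Suc a \<in> L ` C"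
proof -
  interpret A: labeled_poset P le L by (rule labeled_posetI) fact
  let ?D = "ext_promotion P le L"
  have "a \<in> ?D ` P"
    using A.ext_promotion_labeling a by (auto simp: labelings_def bij_betw_def)
  then obtain x where x: "x \<in> P" "?D x = a" by auto
  then have top: "\<not> A.top_of_chain x" using a by (auto simp: A.ext_promotion_eq)
  then have src: "A.source x \<in> P" "L (A.source x) = Suc a"
    using x A.label_source[OF x(1) top] A.source_mem by (auto simp: A.ext_promotion_eq)
  have "a \<in> ?D ` C \<longleftrightarrow> x \<in> C"
    using x A.ext_promotion_inj C_subset by (auto simp: inj_on_eq_iff subset_iff)
  also have "\<dots> \<longleftrightarrow> A.source x \<in> C"
    using C_closed A.le_source x top by blast
  also have "\<dots> \<longleftrightarrow> Suc a \<in> L ` C"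
    using src A.label_inj C_subset by (metis image_iff inj_on_eq_iff subsetD)
  finally show ?thesis .
qed

text \<open>Taken at \<open>a = 1\<close>, this tells which promotions of \<open>P\<close> act on
  \<open>C\<close>: the one after \<open>k\<close> steps does so exactly when the original label
  \<open>k + 1\<close> lies in \<open>C\<close>. The bound on \<open>a + k\<close> excludes
  wrap-around.\<close>

lemma ext_promotion_iter_labels:
  assumes "L \<in> labelings P"
  shows "1 \<le> a \<Longrightarrow> a + k \<le> card P \<Longrightarrow> a \<in> (ext_promotion P le ^^ k) L ` C \<longleftrightarrow> a + k \<in> L ` C"
proof (induction k arbitrary: a)
  case (Suc k)
  then show ?case
    using ext_promotion_labels[OF ext_promotion_iter_labeling[OF assms], of a k] by simp
qed simp

text \<open>Each original label of \<open>C\<close> accounts for one promotion of \<open>C\<close>,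
  at the step when it has moved down to 1. All other steps preserve the order on
  \<open>C\<close>.\<close>

lemma same_order_ext_promotion_iter:
  assumes L: "L \<in> labelings P" and g: "g \<in> labelings C" and so: "same_order_on C g L"
  shows "k \<le> card P \<Longrightarrow> same_order_on C
    ((ext_promotion C leC ^^ card {x\<in>C. L x \<le> k}) g) ((ext_promotion P le ^^ k) L)"
proof (induction k)
  case 0
  interpret A: labeled_poset P le L by (rule labeled_posetI) fact
  have "{x\<in>C. L x \<le> 0} = {}"
    using A.label_range C_subset by fastforce
  then have "card {x\<in>C. L x \<le> 0} = 0" by (simp only: card.empty)
  then show ?case using so by (simp only: funpow.simps id_apply)
next
  case (Suc k)
  interpret A: labeled_poset P le L by (rule labeled_posetI) fact
  let ?K = "(ext_promotion P le ^^ k) L"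
  let ?h = "(ext_promotion C leC ^^ card {x\<in>C. L x \<le> k}) g"
  have K: "?K \<in> labelings P" and h: "?h \<in> labelings C"
    using ext_promotion_iter_labeling[OF L] sub.ext_promotion_iter_labeling[OF g] by blast+
  have so': "same_order_on C ?h ?K" using Suc by simp
  have iff: "1 \<in> ?K ` C \<longleftrightarrow> Suc k \<in> L ` C"
    using ext_promotion_iter_labels[OF L, of 1 k] Suc.prems by simp
  show ?case
  proof (cases "Suc k \<in> L ` C")
    case True
    then obtain x where x: "x \<in> C" "L x = Suc k" by auto
    have "{y\<in>C. L y \<le> Suc k} = insert x {y\<in>C. L y \<le> k}"
      using x A.label_eq_iff[of _ x] C_subset by (auto simp: le_Suc_eq)
    then have card: "card {y\<in>C. L y \<le> Suc k} = Suc (card {y\<in>C. L y \<le> k})"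
      using x finite_C by simp
    obtain v where "v \<in> C" "?K v = 1" using iff True by auto
    then show ?thesis
      using same_order_ext_promotion_inside[OF K h so'] card by simp
  next
    case False
    then have eq: "{y\<in>C. L y \<le> Suc k} = {y\<in>C. L y \<le> k}" by (force simp: le_Suc_eq)
    have "1 \<notin> ?K ` C" using iff False by simp
    from same_order_on_trans[OF so' same_order_ext_promotion_outside[OF K this]]
    show ?thesis by (simp add: eq)
  qed
qed

lemma inv_into_mem_iff:
  assumes "L \<in> labelings P" "a \<in> {1..card P}"
  shows "inv_into P L a \<in> C \<longleftrightarrow> a \<in> L ` C"
proof -
  have L: "inj_on L P" "L ` P = {1..card P}"
    using assms(1) by (auto simp: labelings_def bij_betw_def)
  have "inv_into P L a \<in> P" "L (inv_into P L a) = a"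
    using assms(2) L by (simp_all add: inv_into_into f_inv_into_f)
  then show ?thesis
    using L(1) C_subset by (metis image_iff inj_on_eq_iff subsetD)
qed

text \<open>The exponent is \<open>card C\<close> minus the number of the two largest labels in
  \<open>C\<close>. With both in \<open>C\<close> it is the exponent in the definition of
  \<open>tangled\<close>; otherwise it is at least \<open>card C - 1\<close>, which sorts every
  labeling.\<close>

lemma not_linear_extension_iter_iff:
  assumes L: "L \<in> labelings P" and g: "g \<in> labelings C" and n: "2 \<le> card P"
  shows "\<not> linear_extension C leC ((ext_promotion C leC ^^ card {x\<in>C. L x \<le> card P - 2}) g) \<longleftrightarrow>
    tangled C leC g \<and> inv_into P L (card P - 1) \<in> C \<and> inv_into P L (card P) \<in> C"
proof -
  interpret A: labeled_poset P le L by (rule labeled_posetI) fact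
  let ?n = "card P"
  let ?a = "inv_into P L (?n - 1)" and ?b = "inv_into P L ?n"
  let ?S = "{x\<in>C. L x \<le> ?n - 2}"
  have ab: "?a \<in> P" "?b \<in> P" "L ?a = ?n - 1" "L ?b = ?n"
    using A.label_image n by (auto intro!: inv_into_into f_inv_into_f)
  then have neq: "?a \<noteq> ?b" using n by fastforce
  have S: "?S = C - {?a, ?b}"
  proof (rule set_eqI)
    fix x
    show "x \<in> ?S \<longleftrightarrow> x \<in> C - {?a, ?b}"
    proof (cases "x \<in> C")
      case True
      then have x: "x \<in> P" using C_subset by blast
      have "L x \<le> ?n - 2 \<longleftrightarrow> L x \<noteq> L ?a \<and> L x \<noteq> L ?b"
        using A.label_range[OF x] n ab by linarith
      then show ?thesis
        using True A.label_eq_iff[OF x ab(1)] A.label_eq_iff[OF x ab(2)] by simp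
    qed simp
  qed
  show ?thesis
  proof (cases "?a \<in> C \<and> ?b \<in> C")
    case True
    then have sub: "{?a, ?b} \<subseteq> C" and two: "card {?a, ?b} = 2" using neq by auto
    have "card ?S = card C - 2"
      unfolding S using card_Diff_subset[OF _ sub] two by simp
    moreover have "2 \<le> card C"
      using card_mono[OF finite_C sub] two by simp
    ultimately show ?thesis
      using True g by (simp add: tangled_def)
  next
    case False
    then obtain z where "C - {?a, ?b} = C - {z}" by blast
    then have "card C - 1 \<le> card ?S"
      unfolding S using diff_card_le_card_Diff[of "{z}" C] by simp
    then have "linear_extension C leC ((ext_promotion C leC ^^ card ?S) g)"
      by (intro sub.ext_promotion_iter_linear_extension[OF g]) simp
    then show ?thesis using False by blast
  qed
qed

end

section \<open>Decomposition into connected components\<close>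

context finite_poset
begin

lemma equiv_components: "equiv P (Restr ((hasse_diagram le \<union> (hasse_diagram le)\<inverse>)\<^sup>*) P)"
proof (rule equivI)
  have "sym ((hasse_diagram le \<union> (hasse_diagram le)\<inverse>)\<^sup>*)"
    by (rule sym_rtrancl) (auto simp: sym_def)
  then show "sym (Restr ((hasse_diagram le \<union> (hasse_diagram le)\<inverse>)\<^sup>*) P)"
    by (auto simp: sym_def)
  show "trans (Restr ((hasse_diagram le \<union> (hasse_diagram le)\<inverse>)\<^sup>*) P)"
    by (auto simp: trans_def intro: rtrancl_trans)
qed (auto simp: refl_on_def)

lemma component_closed_subposet:
  assumes "C \<in> poset_components P le"
  shows "closed_subposet P le C"
proof
  let ?R = "Restr ((hasse_diagram le \<union> (hasse_diagram le)\<inverse>)\<^sup>*) P"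
  have C: "C \<in> P // ?R" using assms by (simp add: poset_components_def)
  show "C \<subseteq> P" by (rule in_quotient_imp_subset[OF equiv_components C])
  fix x y assume xy: "(x, y) \<in> le"
  then have "(x, y) \<in> ((hasse_diagram le \<union> (hasse_diagram le)\<inverse>)\<^sup>*)"
    using hasse_rtrancl rtrancl_mono[of "hasse_diagram le" "hasse_diagram le \<union> (hasse_diagram le)\<inverse>"]
    by blast
  then have R: "(x, y) \<in> ?R" using xy le_subset by blast
  then have "(y, x) \<in> ?R" using equiv_components by (meson equivE symE)
  then show "x \<in> C \<longleftrightarrow> y \<in> C"
    using R in_quotient_imp_closed[OF equiv_components C] by blast
qed

lemma Union_components: "\<Union> (poset_components P le) = P"
  unfolding poset_components_def by (rule Union_quotient[OF equiv_components])

lemma finite_components: "finite (poset_components P le)"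
  using Union_components finite by (metis finite_UnionD)

lemma components_disjoint:
  "C \<in> poset_components P le \<Longrightarrow> D \<in> poset_components P le \<Longrightarrow> x \<in> C \<Longrightarrow> x \<in> D \<Longrightarrow> C = D"
  unfolding poset_components_def using quotient_disj[OF equiv_components] by blast

text \<open>Every comparable pair lies in a single component, where \<open>g C\<close> and
  \<open>L\<close> order it alike.\<close>

lemma linear_extension_iff_components:
  assumes L: "L \<in> labelings P"
    and g: "\<And>C. C \<in> poset_components P le \<Longrightarrow> g C \<in> labelings C \<and> same_order_on C (g C) L"
  shows "linear_extension P le L \<longleftrightarrow>
    (\<forall>C \<in> poset_components P le. linear_extension C (Restr le C) (g C))"
proof -
  have "(\<forall>(x, y) \<in> le. L x \<le> L y) \<longleftrightarrow>
    (\<forall>C \<in> poset_components P le. \<forall>(x, y) \<in> Restr le C. L x \<le> L y)"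
  proof (intro iffI ballI, goal_cases)
    case (2 e)
    obtain x y where e: "e = (x, y)" by (cases e)
    then obtain C where C: "C \<in> poset_components P le" "x \<in> C"
      using Union_components 2 le_subset by blast
    then have "y \<in> C"
      using component_closed_subposet[OF C(1)] 2 e by (simp add: closed_subposet.C_closed)
    then show ?case using 2 C e by auto
  qed auto
  also have "\<dots> \<longleftrightarrow> (\<forall>C \<in> poset_components P le. \<forall>(x, y) \<in> Restr le C. g C x \<le> g C y)"
    using g by (intro ball_cong refl) (auto dest: same_order_on_leD)
  finally show ?thesis
    using L g by (auto simp: linear_extension_def)
qed

lemma tangled_iff_component:
  assumes L: "L \<in> labelings P"
  shows "tangled P le L \<longleftrightarrow>
    (\<exists>C \<in> poset_components P le.
       tangled C (Restr le C) (standardization C (restrict L C)) \<and>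
       inv_into P L (card P - 1) \<in> C \<and> inv_into P L (card P) \<in> C)"
proof (cases "2 \<le> card P")
  \<comment> \<open>With fewer than two elements both sides are false, so the arbitrary value of
    \<open>inv_into\<close> at a label that does not occur is harmless.\<close>
  case False
  have "\<not> tangled C (Restr le C) h" if "C \<in> poset_components P le" for C h
  proof -
    have "card C \<le> card P"
      using Union_components that finite by (intro card_mono) auto
    then show ?thesis using False by (simp add: tangled_def)
  qed
  then show ?thesis using False by (auto simp: tangled_def)
next
  case True
  let ?st = "\<lambda>C. standardization C (restrict L C)"
  \<comment> \<open>The state that the standardization on \<open>C\<close> has reached after
    \<open>card P - 2\<close> promotions of \<open>P\<close>.\<close>
  let ?g = "\<lambda>C. (ext_promotion C (Restr le C) ^^ card {x\<in>C. L x \<le> card P - 2}) (?st C)"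
  let ?K = "(ext_promotion P le ^^ (card P - 2)) L"
  have st: "?st C \<in> labelings C \<and> same_order_on C (?st C) L" if "C \<in> poset_components P le" for C
  proof -
    interpret closed_subposet P le C by (rule component_closed_subposet) fact
    have "inj_on L C"
      using L C_subset by (auto simp: labelings_def bij_betw_def intro: inj_on_subset)
    then have inj: "inj_on (restrict L C) C" by simp
    show ?thesis
      using standardization_labeling[OF finite_C inj] standardization_same_order[OF finite_C inj]
      by (simp add: same_order_on_def)
  qed
  have g: "?g C \<in> labelings C \<and> same_order_on C (?g C) ?K" if C: "C \<in> poset_components P le" for C
  proof -
    interpret closed_subposet P le C by (rule component_closed_subposet) fact
    show ?thesis
      using same_order_ext_promotion_iter[OF L] sub.ext_promotion_iter_labeling st[OF C] by simp
  qed
  have "tangled P le L \<longleftrightarrow> \<not> linear_extension P le ?K"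
    using True L by (simp add: tangled_def)
  also have "\<dots> \<longleftrightarrow> (\<exists>C \<in> poset_components P le. \<not> linear_extension C (Restr le C) (?g C))"
    using linear_extension_iff_components[OF ext_promotion_iter_labeling[OF L], where g = ?g] g by blast
  also have "\<dots> \<longleftrightarrow> (\<exists>C \<in> poset_components P le. tangled C (Restr le C) (?st C) \<and>
      inv_into P L (card P - 1) \<in> C \<and> inv_into P L (card P) \<in> C)"
    using closed_subposet.not_linear_extension_iter_iff[OF component_closed_subposet L _ True] st
    by (intro bex_cong refl) blast
  finally show ?thesis .
qed

end

section \<open>Counting\<close>

text \<open>The product is the falling factorial, in the form in which the library counts
  injections.\<close>

lemma prod_falling_fact:
  assumes "m \<le> N"
  shows "prod ((-) N) {0..<m} * fact (N - m) = (fact N :: nat)"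
  using assms
proof (induction m)
  case (Suc m)
  have "(fact (N - m) :: nat) = (N - m) * fact (N - Suc m)"
    using Suc.prems by (metis Suc_diff_Suc Suc_le_lessD fact_Suc of_nat_id)
  then show ?case using Suc by (simp add: mult.assoc)
qed simp

lemma finite_labelings:
  assumes "finite P"
  shows "finite (labelings P)"
proof (rule finite_subset)
  show "labelings P \<subseteq> P \<rightarrow>\<^sub>E {1..card P}"
    by (auto simp: labelings_def bij_betw_def PiE_def)
  show "finite (P \<rightarrow>\<^sub>E {1..card P})"
    using assms by (simp add: finite_PiE)
qed

text \<open>A labeling whose two largest labels lie in \<open>C\<close> is determined by its standardization on \<open>C\<close>
  together with an arbitrary injection of the complement into the remaining labels.\<close>

lemma bij_betw_labelings_standardization:
  assumes fin: "finite P" and C: "C \<subseteq> P" and T: "T \<subseteq> labelings C" and c: "2 \<le> card C"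
  shows "bij_betw (\<lambda>L. (standardization C (restrict L C), restrict L (P - C)))
    {L \<in> labelings P. standardization C (restrict L C) \<in> T \<and> card P - 1 \<in> L ` C \<and> card P \<in> L ` C}
    (T \<times> {h \<in> (P - C) \<rightarrow>\<^sub>E {1..card P - 2}. inj_on h (P - C)})"
    (is "bij_betw ?F ?S (T \<times> ?H)")
proof -
  let ?n = "card P"
  have finC: "finite C" using C fin finite_subset by blast
  have n: "2 \<le> ?n" using c card_mono[OF fin C] by simp
  have lab: "inj_on L P" "L ` P = {1..?n}" "inj_on L C" "L ` (P - C) = {1..?n} - L ` C" "L ` C = {1..?n} - L ` (P - C)"
    if "L \<in> labelings P" for L
  proof -
    show *: "inj_on L P" "L ` P = {1..?n}" using that by (auto simp: labelings_def bij_betw_def)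
    show "inj_on L C" using * C inj_on_subset by blast
    show **: "L ` (P - C) = {1..?n} - L ` C" using * C inj_on_image_set_diff[of L P P C] by simp
    show "L ` C = {1..?n} - L ` (P - C)" using ** image_mono[OF C, of L] *(2) by blast
  qed
  have st: "same_order_on C (standardization C (restrict L C)) L" if "L \<in> labelings P" for L
    using standardization_same_order[OF finC, of "restrict L C"] lab(3)[OF that]
    by (simp add: same_order_on_def)
  have inj: "inj_on ?F ?S"
  proof (rule inj_onI)
    fix L M assume L: "L \<in> ?S" and M: "M \<in> ?S" and eq: "?F L = ?F M"
    have out: "L x = M x" if "x \<in> P - C" for x
      using eq that by (metis prod.inject restrict_apply')
    \<comment> \<open>Agreement off \<open>C\<close> leaves the same labels for \<open>C\<close>;
      together with equal standardizations this determines the labeling on \<open>C\<close>.\<close>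
    then have "L ` (P - C) = M ` (P - C)" by (auto intro: image_cong)
    then have img: "L ` C = M ` C" using lab(5)[of L] lab(5)[of M] L M by simp
    have so: "same_order_on C L M"
      using st[of L] st[of M] L M eq by (auto simp: same_order_on_def)
    have "L x = M x" if "x \<in> C" for x
      by (rule same_order_on_eq[OF finC _ _ img so that]) (use lab(3) L M in auto)
    then show "L = M"
      using L M out by (intro extensionalityI[of L P M]) (auto simp: labelings_def)
  qed
  have into: "?F L \<in> T \<times> ?H" if L: "L \<in> ?S" for L
  proof -
    have "L x \<in> {1..?n - 2}" if "x \<in> P - C" for x
    proof -
      have "L x \<in> {1..?n} - L ` C" using lab(4)[of L] L that by auto
      then have "L x \<noteq> ?n" "L x \<noteq> ?n - 1" "1 \<le> L x" "L x \<le> ?n" using L by auto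
      then show ?thesis by auto
    qed
    moreover have "inj_on L (P - C)" using lab(1)[of L] L inj_on_subset by blast
    ultimately show ?thesis using L by auto
  qed
  have onto: "(g, h) \<in> ?F ` ?S" if g: "g \<in> T" and h: "h \<in> ?H" for g h
  proof -
    \<comment> \<open>The labels that \<open>h\<close> leaves over for \<open>C\<close>. Below,
      \<open>e\<close> lists them increasingly from index 0, hence the shift \<open>g x - 1\<close>
      in the definition of \<open>L\<close>.\<close>
    define A where "A = {1..?n} - h ` (P - C)"
    have hP: "h ` (P - C) \<subseteq> {1..?n - 2}" and hinj: "inj_on h (P - C)" using h by auto
    have sub: "h ` (P - C) \<subseteq> {1..?n}" using hP by force
    have cardA: "card A = card C"
      using sub hinj C finC fin card_mono[OF fin C]
      by (simp add: A_def card_Diff_subset card_image finite_subset[OF hP])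
    obtain e where e: "bij_betw e {..<card A} A" "strict_mono_on {..<card A} e"
      using ex_bij_betw_strict_mono_card[of A] by (auto simp: A_def)
    have gl: "g \<in> labelings C" using g T by blast
    then have gb: "bij_betw g C {1..card C}" by (simp add: labelings_def)
    have "bij_betw (\<lambda>i. i - 1) {1..card C} {..<card C}"
      by (rule bij_betw_byWitness[where f' = Suc]) auto
    then have eg: "bij_betw (e \<circ> ((\<lambda>i. i - 1) \<circ> g)) C A"
      using bij_betw_trans[OF bij_betw_trans[OF gb] e(1)] cardA by (simp add: comp_assoc)
    define L where "L = (\<lambda>x. if x \<in> C then e (g x - 1) else h x)"
    have LC: "bij_betw L C A"
      using eg by (rule bij_betw_cong[THEN iffD1, rotated]) (simp add: L_def)
    have Lh: "bij_betw L (P - C) (h ` (P - C))"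
      using hinj by (intro bij_betw_cong[THEN iffD1, OF _ inj_on_imp_bij_betw]) (auto simp: L_def)
    have "bij_betw L (C \<union> (P - C)) (A \<union> h ` (P - C))"
      by (rule bij_betw_combine[OF LC Lh]) (auto simp: A_def)
    moreover have "C \<union> (P - C) = P" "A \<union> h ` (P - C) = {1..?n}" using C sub by (auto simp: A_def)
    ultimately have "bij_betw L P {1..?n}" by simp
    moreover have "L \<in> extensional P"
      using h C by (auto simp: L_def extensional_def PiE_def)
    ultimately have Ll: "L \<in> labelings P" by (simp add: labelings_def)
    have range: "1 \<le> g x \<and> g x \<le> card C" if "x \<in> C" for x
      using gb that by (metis atLeastAtMost_iff bij_betw_apply)
    have "same_order_on C g (restrict L C)"
      unfolding same_order_on_def
    proof (intro ballI)
      fix x y assume xy: "x \<in> C" "y \<in> C"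
      have "e (g x - 1) < e (g y - 1) \<longleftrightarrow> g x - 1 < g y - 1"
        by (rule strict_mono_on_less[OF e(2)]) (use range[OF xy(1)] range[OF xy(2)] cardA in auto)
      then show "g x < g y \<longleftrightarrow> restrict L C x < restrict L C y"
        using xy range[OF xy(1)] range[OF xy(2)] by (auto simp: L_def)
    qed
    then have stL: "standardization C (restrict L C) = g"
      by (rule standardization_eqI[OF finC gl])
    have "restrict L (P - C) = h"
      using h by (intro extensionalityI[of _ "P - C"]) (auto simp: L_def PiE_def)
    \<comment> \<open>The range of \<open>h\<close> stops at \<open>card P - 2\<close>, so the two
      largest labels remain in \<open>A\<close>, the image of \<open>C\<close>.\<close>
    moreover have "?n - 1 \<notin> {1..?n - 2}" "?n \<notin> {1..?n - 2}" using n by auto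
    then have "?n - 1 \<in> A" "?n \<in> A"
      using hP n by (auto simp: A_def simp del: atLeastAtMost_iff) auto
    then have "?n - 1 \<in> L ` C" "?n \<in> L ` C"
      using LC by (auto simp: bij_betw_def)
    ultimately show ?thesis
      using Ll stL g by (intro image_eqI[of _ _ L]) auto
  qed
  show ?thesis
    unfolding bij_betw_def
  proof (intro conjI subset_antisym)
    show "?F ` ?S \<subseteq> T \<times> ?H" using into by (rule image_subsetI)
    show "T \<times> ?H \<subseteq> ?F ` ?S" using onto by (rule subrelI) (auto simp only: mem_Sigma_iff)
  qed (rule inj)
qed

context closed_subposet
begin

text \<open>The bijection gives a product: tangled labelings of \<open>C\<close> times injections of
  \<open>P - C\<close> into \<open>card P - 2\<close> labels. The latter number is a falling
  factorial, and it ends at \<open>(card C - 2)!\<close> because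
  \<open>card P - 2 - (card P - card C) = card C - 2\<close>.\<close>

lemma card_tangled_on:
  assumes n: "2 \<le> card P"
  shows "real (card {L \<in> labelings P. tangled C leC (standardization C (restrict L C)) \<and>
      inv_into P L (card P - 1) \<in> C \<and> inv_into P L (card P) \<in> C}) =
    fact (card P - 2) * (if card C = 1 then 0 else real (num_tangled C leC) / fact (card C - 2))"
    (is "real (card ?S) = _")
proof (cases "2 \<le> card C")
  case False
  then have "\<not> tangled C leC g" for g by (simp add: tangled_def)
  then show ?thesis by (simp add: num_tangled_def)
next
  case True
  let ?T = "{g. tangled C leC g}"
  let ?H = "{h \<in> (P - C) \<rightarrow>\<^sub>E {1..card P - 2}. inj_on h (P - C)}"
  have T: "?T \<subseteq> labelings C" by (auto simp: tangled_def)
  have "?S = {L \<in> labelings P. standardization C (restrict L C) \<in> ?T \<and> card P - 1 \<in> L ` C \<and> card P \<in> L ` C}"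
    using n by (intro Collect_cong conj_cong refl) (auto simp: inv_into_mem_iff)
  then have "card ?S = card (?T \<times> ?H)"
    using bij_betw_same_card[OF bij_betw_labelings_standardization[OF finite C_subset T True]] by simp
  also have "\<dots> = num_tangled C leC * card ?H"
    by (simp add: card_cartesian_product num_tangled_def)
  finally have S: "card ?S = num_tangled C leC * card ?H" .
  have le: "card C \<le> card P" using C_subset finite card_mono by blast
  have diff: "card (P - C) = card P - card C"
    using C_subset finite_C by (rule card_Diff_subset[rotated])
  have "card ?H = prod ((-) (card P - 2)) {0..<card P - card C}"
    using card_inj_on_subset_funcset[of "P - C" "{1..card P - 2}" "P - C"] finite diff by simp
  moreover have "card P - 2 - (card P - card C) = card C - 2"
    using True le by simp
  ultimately have "card ?H * fact (card C - 2) = fact (card P - 2)"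
    using prod_falling_fact[of "card P - card C" "card P - 2"] True by simp
  from arg_cong[OF this, of real] have "real (card ?H) * fact (card C - 2) = fact (card P - 2)"
    by (simp only: of_nat_mult of_nat_fact)
  then have "real (card ?H) = fact (card P - 2) / fact (card C - 2)"
    by (simp add: field_simps)
  then show ?thesis using S True by simp
qed

end

context finite_poset
begin

text \<open>The component in the criterion is unique, since the element with the largest label lies
  in only one; the labelings therefore split into disjoint classes.\<close>

lemma num_tangled_eq_sum:
  assumes n: "2 \<le> card P"
  shows "real (num_tangled P le) = fact (card P - 2) *
    (\<Sum>C \<in> poset_components P le.
       if card C = 1 then 0 else real (num_tangled C (Restr le C)) / fact (card C - 2))"
proof -
  let ?S = "\<lambda>C. {L \<in> labelings P. tangled C (Restr le C) (standardization C (restrict L C)) \<and>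
      inv_into P L (card P - 1) \<in> C \<and> inv_into P L (card P) \<in> C}"
  have "{L. tangled P le L} = (\<Union>C \<in> poset_components P le. ?S C)"
    using tangled_iff_component by (auto simp: tangled_def[of P])
  moreover have "card (\<Union>C \<in> poset_components P le. ?S C) = (\<Sum>C \<in> poset_components P le. card (?S C))"
    using finite_labelings[OF finite] components_disjoint
    by (intro card_UN_disjoint finite_components) auto
  ultimately have "real (num_tangled P le) = (\<Sum>C \<in> poset_components P le. real (card (?S C)))"
    by (simp add: num_tangled_def)
  also have "\<dots> = (\<Sum>C \<in> poset_components P le. fact (card P - 2) *
      (if card C = 1 then 0 else real (num_tangled C (Restr le C)) / fact (card C - 2)))"
    by (intro sum.cong refl closed_subposet.card_tangled_on[OF component_closed_subposet n])
  finally show ?thesis by (simp only: sum_distrib_left)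
qed

end

theorem theorem3p4:
  fixes P :: "'a set" and le :: "'a rel" and n :: nat
  assumes "finite P" and "partial_order_on P le" and "card P = n"
  shows "(\<forall>L \<in> labelings P.
            tangled P le L \<longleftrightarrow>
            (\<exists>C \<in> poset_components P le.
               tangled C (Restr le C) (standardization C (restrict L C)) \<and>
               inv_into P L (n - 1) \<in> C \<and> inv_into P L n \<in> C)) \<and>
         (n \<ge> 2 \<longrightarrow>
            real (num_tangled P le) =
              fact (n - 2) *
              (\<Sum>C \<in> poset_components P le.
                 if card C = 1 then 0
                 else real (num_tangled C (Restr le C)) / fact (card C - 2)))"
proof -
  interpret finite_poset P le by unfold_locales fact+
  show ?thesis
    using tangled_iff_component num_tangled_eq_sum unfolding assms(3)[symmetric] by blast
qed

end
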